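(* Let $f:\mathbb R^2\to(0,\infty)$ be $$f(\xi_1,\xi_2)=\frac{1}{2\sqrt{\pi}}(1+\xi_1^2)^{-3/2}\exp\!\Big(-\xi_1^2-\frac{\xi_2^2}{4(1+\xi_1^2)}\Big),$$ let $G(u)=\int_{\mathbb R^2}e^{\langle u,\xi\rangle}f(\xi)\,d\xi$ for $u\in\mathbb R^2$, and $V=\{u\in\mathbb R^2: G(u)<\infty\}$. Let $\mu_4$ be the finite measure on $\mathbb R^4$ with Lebesgue density $f(\xi_1,\xi_2)f(\xi_3,\xi_4)$, let $G_4(u)=\int_{\mathbb R^4}e^{\langle u,\xi\rangle}\mu_4(d\xi)$ for $u\in\mathbb R^4$, and $V_4=\{u\in\mathbb R^4: G_4(u)<\infty\}$. Then: (i) the boundary $\partial V_4$ contains the set $V\times\{(0,1)\}=\{(u_1,u_2,0,1):(u_1,u_2)\in V\}$; (ii) $G_4(u_1,u_2,0,1)=e\pi\,G(u_1,u_2)$ for all $(u_1,u_2)\in V$; (iii) in particular, there exists a probability measure $\nu$ on $\mathbb R^4$ whose moment generating function $G_\nu(u)=\int_{\mathbb R^4} e^{\langle u,\xi\rangle}\nu(d\xi)$, with domain $V_\nu=\{u\in\mathbb R^4:G_\nu(u)<\infty\}$ having nonempty interior, has the following property: there exists a continuous curve $c:[0,1]\to\partial V_\nu$ with $c([0,1))\subset V_\nu$, and a sequence $t_k\uparrow1$ in $[0,1)$, such that the sequence $(G_\nu(c(t_k)))_{k\ge1}$ has an accumulation point $p\in[0,\infty]$ with $p\ne G_\nu(c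(1))$.
   Context: Here $\langle\cdot,\cdot\rangle$ is the standard Euclidean scalar product, $(0,1)$ denotes the point of $\mathbb R^2$ with coordinates $0$ and $1$ (not an interval), $e$ is Euler's number, and $\partial$ denotes topological boundary. An accumulation point of a sequence is the limit, in $[0,\infty]$, of one of its subsequences. For the planar density $f$ one has $V=(\mathbb R\times(-1,1))\cup\{(0,1),(0,-1)\}$, where $(-1,1)$ is the open interval and $(0,\pm1)$ are points. *)

theory Defs
  imports "HOL-Probability.Probability"
begin

lemma vector_4 [simp]:
  "(vector [a, b, c, d] :: 'a::zero^4) $ 1 = a"
  "(vector [a, b, c, d] :: 'a::zero^4) $ 2 = b"
  "(vector [a, b, c, d] :: 'a::zero^4) $ 3 = c"
  "(vector [a, b, c, d] :: 'a::zero^4) $ 4 = d"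
  unfolding vector_def by simp_all

definition mgf :: "'a::euclidean_space measure \<Rightarrow> 'a \<Rightarrow> ennreal" where
  "mgf M u = (\<integral>\<^sup>+\<xi>. ennreal (exp (u \<bullet> \<xi>)) \<partial>M)"

definition mgf_domain :: "'a::euclidean_space measure \<Rightarrow> 'a set" where
  "mgf_domain M = {u. mgf M u < \<infinity>}"

definition f\<^sub>2 :: "real^2 \<Rightarrow> real" where
  "f\<^sub>2 \<xi> = 1 / (2 * sqrt pi) * (1 + (\<xi> $ 1)\<^sup>2) powr (- (3 / 2))
          * exp (- (\<xi> $ 1)\<^sup>2 - (\<xi> $ 2)\<^sup>2 / (4 * (1 + (\<xi> $ 1)\<^sup>2)))"

definition G\<^sub>2 :: "real^2 \<Rightarrow> ennreal" where
  "G\<^sub>2 u = (\<integral>\<^sup>+\<xi>. ennreal (exp (u \<bullet> \<xi>) * f\<^sub>2 \<xi>) \<partial>lborel)"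

definition V\<^sub>2 :: "(real^2) set" where
  "V\<^sub>2 = {u. G\<^sub>2 u < \<infinity>}"

definition \<mu>\<^sub>4 :: "(real^4) measure" where
  "\<mu>\<^sub>4 = density lborel (\<lambda>\<xi>. ennreal (f\<^sub>2 (vector [\<xi> $ 1, \<xi> $ 2]) * f\<^sub>2 (vector [\<xi> $ 3, \<xi> $ 4])))"

definition G\<^sub>4 :: "real^4 \<Rightarrow> ennreal" where
  "G\<^sub>4 = mgf \<mu>\<^sub>4"

definition V\<^sub>4 :: "(real^4) set" where
  "V\<^sub>4 = mgf_domain \<mu>\<^sub>4"

lemma f\<^sub>2_pos: "f\<^sub>2 \<xi> > 0"
proof -
  have "1 + (\<xi> $ 1)\<^sup>2 > 0" by (simp add: add_pos_nonneg)
  then show ?thesis by (simp add: f\<^sub>2_def)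
qed

lemma f\<^sub>2_le:
  "f\<^sub>2 (vector [x, y]) \<le> 4 * (inverse (1 + x\<^sup>2) * inverse (1 + y\<^sup>2))"
proof -
  define s where "s = 1 + x\<^sup>2"
  have s: "s \<ge> 1" by (simp add: s_def)
  have e: "exp (- a) \<le> inverse (1 + a)" if "a \<ge> 0" for a :: real
    using exp_ge_add_one_self[of a] that
    by (simp add: exp_minus le_imp_inverse_le)
  have e1: "exp (- x\<^sup>2) \<le> inverse s"
    unfolding s_def by (rule e) simp
  have "exp (- (y\<^sup>2 / (4 * s))) \<le> inverse (1 + y\<^sup>2 / (4 * s))"
    using s by (intro e) simp
  also have "\<dots> = 4 * s / (4 * s + y\<^sup>2)"
    using s by (simp add: field_simps)
  also have "\<dots> \<le> 4 * s / (1 + y\<^sup>2)"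
    using s by (intro divide_left_mono mult_pos_pos) (auto simp: add_pos_nonneg)
  finally have e2: "exp (- (y\<^sup>2 / (4 * s))) \<le> 4 * s / (1 + y\<^sup>2)" .
  have p: "s powr (- (3 / 2)) \<le> s powr (- 1)"
    using s by (intro powr_mono) auto
  also have "\<dots> = inverse s" using s by (simp add: powr_minus)
  finally have p: "s powr (- (3 / 2)) \<le> inverse s" .
  have "1 \<le> pi" using pi_ge_two by linarith
  then have "1 \<le> sqrt pi" by simp
  then have "1 \<le> 2 * sqrt pi" by linarith
  then have q: "1 / (2 * sqrt pi) \<le> 1" by simp
  have "f\<^sub>2 (vector [x, y])
      = (1 / (2 * sqrt pi) * s powr (- (3 / 2))) * (exp (- x\<^sup>2) * exp (- (y\<^sup>2 / (4 * s))))"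
    by (simp add: f\<^sub>2_def s_def exp_diff exp_minus field_simps)
  also have "\<dots> \<le> (1 * inverse s) * (inverse s * (4 * s / (1 + y\<^sup>2)))"
    using s by (intro mult_mono q p e1 e2) auto
  also have "\<dots> = 4 * (inverse s * inverse (1 + y\<^sup>2))"
    using s by (simp add: field_simps)
  finally show ?thesis by (simp add: s_def)
qed

lemma finite_measure_\<mu>\<^sub>4: "finite_measure \<mu>\<^sub>4"
proof
  define h :: "real \<Rightarrow> real" where "h x = inverse (1 + x\<^sup>2)" for x
  have h0: "h x \<ge> 0" for x by (simp add: h_def)
  have [measurable]: "h \<in> borel_measurable borel" unfolding h_def by measurable
  have "integrable lborel h"
    using integrable_inverse_1_plus_square
    by (simp add: set_integrable_def einterval_def h_def[abs_def])
  then have fin: "(\<integral>\<^sup>+x. ennreal (h x) \<partial>lborel) < \<infinity>"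
    using h0 by (simp add: integrable_iff_bounded)
  have prod: "(\<Prod>b\<in>Basis. ennreal (h (\<xi> \<bullet> b)))
      = ennreal (h (\<xi> $ 1) * h (\<xi> $ 2) * h (\<xi> $ 3) * h (\<xi> $ 4))" for \<xi> :: "real^4"
  proof -
    have inj: "inj (\<lambda>i::4. axis i (1::real))" by (auto simp: inj_on_def axis_eq_axis)
    have B: "(Basis :: (real^4) set) = range (\<lambda>i. axis i 1)"
      by (auto simp: Basis_vec_def)
    have "(\<Prod>b\<in>Basis. ennreal (h (\<xi> \<bullet> b))) = (\<Prod>i\<in>UNIV. ennreal (h (\<xi> $ i)))"
      unfolding B by (subst prod.reindex[OF inj]) (simp add: inner_axis)
    also have "\<dots> = ennreal (\<Prod>i\<in>UNIV. h (\<xi> $ i))"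
      by (simp add: prod_ennreal h0)
    also have "(\<Prod>i\<in>UNIV. h (\<xi> $ i)) = h (\<xi> $ 1) * h (\<xi> $ 2) * h (\<xi> $ 3) * h (\<xi> $ 4)"
      unfolding UNIV_4 by (simp add: mult.assoc)
    finally show ?thesis .
  qed
  have m: "f\<^sub>2 \<in> borel_measurable borel"
    unfolding f\<^sub>2_def[abs_def] by measurable
  have vm: "(\<lambda>\<xi>::real^4. vector [\<xi> $ i, \<xi> $ j] :: real^2) \<in> borel_measurable borel" for i j
  proof (rule borel_measurable_continuous_onI)
    have "continuous_on UNIV (\<lambda>\<xi>::real^4. (vector [\<xi> $ i, \<xi> $ j] :: real^2) $ k)" for k
      using exhaust_2[of k] by (elim disjE) (simp_all add: continuous_on_component)
    then have "continuous_on UNIV (\<lambda>\<xi>::real^4. \<chi> k. (vector [\<xi> $ i, \<xi> $ j] :: real^2) $ k)"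
      by (rule continuous_on_vec_lambda)
    then show "continuous_on UNIV (\<lambda>\<xi>::real^4. vector [\<xi> $ i, \<xi> $ j] :: real^2)"
      by simp
  qed
  have [measurable]: "(\<lambda>\<xi>::real^4. f\<^sub>2 (vector [\<xi> $ i, \<xi> $ j])) \<in> borel_measurable borel" for i j
    using measurable_compose[OF vm m] .
  have "emeasure \<mu>\<^sub>4 (space \<mu>\<^sub>4)
      = (\<integral>\<^sup>+\<xi>. ennreal (f\<^sub>2 (vector [\<xi> $ 1, \<xi> $ 2]) * f\<^sub>2 (vector [\<xi> $ 3, \<xi> $ 4])) \<partial>(lborel :: (real^4) measure))"
    unfolding \<mu>\<^sub>4_def by (simp add: emeasure_density)
  also have "\<dots> \<le> (\<integral>\<^sup>+\<xi>. ennreal 16 * (\<Prod>b\<in>Basis. ennreal (h (\<xi> \<bullet> b))) \<partial>(lborel :: (real^4) measure))"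
  proof (rule nn_integral_mono)
    fix \<xi> :: "real^4"
    have "f\<^sub>2 (vector [\<xi> $ 1, \<xi> $ 2]) * f\<^sub>2 (vector [\<xi> $ 3, \<xi> $ 4])
        \<le> (4 * (h (\<xi> $ 1) * h (\<xi> $ 2))) * (4 * (h (\<xi> $ 3) * h (\<xi> $ 4)))"
      unfolding h_def by (intro mult_mono f\<^sub>2_le) (auto simp: f\<^sub>2_pos less_imp_le)
    then show "ennreal (f\<^sub>2 (vector [\<xi> $ 1, \<xi> $ 2]) * f\<^sub>2 (vector [\<xi> $ 3, \<xi> $ 4]))
        \<le> ennreal 16 * (\<Prod>b\<in>Basis. ennreal (h (\<xi> \<bullet> b)))"
      unfolding prod by (subst ennreal_mult[symmetric]) (auto simp: h0 mult_ac intro!: ennreal_leI)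
  qed
  also have "\<dots> = ennreal 16 * (\<Prod>b\<in>(Basis :: (real^4) set). (\<integral>\<^sup>+x. ennreal (h x) \<partial>lborel))"
    by (subst nn_integral_cmult, measurable)
      (subst nn_integral_lborel_prod[of "\<lambda>_ x. ennreal (h x)"], simp_all)
  also have "\<dots> < \<infinity>"
    using fin by (simp add: ennreal_mult_less_top power_less_top_ennreal)
  finally show "emeasure \<mu>\<^sub>4 (space \<mu>\<^sub>4) \<noteq> \<infinity>" by simp
qed

end

(*
Integrating out xi_2 gives G(u_1, u_2) = exp(u_2^2) * (integral of exp(u_1 x - (1 - u_2^2) x^2) / (1 + x^2) dx).
On the line u_2 = 1 this is finite only at u_1 = 0, where it equals e * pi. Since G_4 is the product
G(u_1, u_2) G(u_3, u_4), every point (u, 0, 1) with u in V lies on the boundary of V_4, so any curve in V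
yields a boundary curve. Along u = (a, sqrt(1 - a^4)) with a = 1 / n the integrand exceeds
exp(n / 2) / (1 + 4 n^4) for n^2 <= x <= 2 n^2, so G tends to infinity although u tends to the point (0, 1) of V.
*)
theory Submission
  imports Defs "HOL-Real_Asymp.Real_Asymp"
begin

section \<open>Vectors given by coordinates: measurability and continuity\<close>

lemma vector_2_eta: "vector [x $ 1, x $ 2] = (x :: real^2)"
  by (simp add: vec_eq_iff forall_2)

lemma vector_4_eta: "vector [x $ 1, x $ 2, x $ 3, x $ 4] = (x :: real^4)"
  by (simp add: vec_eq_iff forall_4)

text \<open>Stated for a composite rather than for the bare projection, so that the measurability
  prover can use it inside larger expressions such as the density.\<close>

lemma borel_measurable_vec_nth_comp [measurable (raw)]:
  fixes f :: "'a \<Rightarrow> real^'n"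
  assumes "f \<in> borel_measurable M"
  shows "(\<lambda>x. f x $ i) \<in> borel_measurable M"
  using assms by (rule measurable_compose) (intro borel_measurable_continuous_onI continuous_intros)

lemma measurable_vector_2 [measurable (raw)]:
  fixes f g :: "'a \<Rightarrow> real"
  assumes "f \<in> borel_measurable M" "g \<in> borel_measurable M"
  shows "(\<lambda>x. vector [f x, g x] :: real^2) \<in> borel_measurable M"
proof -
  \<comment> \<open>As a combination of the axis vectors, the vector is a sum of scaled constants,
    for which measurability is standard.\<close>
  have "(vector [f x, g x] :: real^2) = f x *\<^sub>R axis 1 1 + g x *\<^sub>R axis 2 1" for x
    by (simp add: vec_eq_iff forall_2 axis_def)
  then show ?thesis using assms by simp
qed

lemma measurable_vector_4 [measurable (raw)]:
  fixes f g h k :: "'a \<Rightarrow> real"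
  assumes "f \<in> borel_measurable M" "g \<in> borel_measurable M"
    "h \<in> borel_measurable M" "k \<in> borel_measurable M"
  shows "(\<lambda>x. vector [f x, g x, h x, k x] :: real^4) \<in> borel_measurable M"
proof -
  have "(vector [f x, g x, h x, k x] :: real^4)
      = f x *\<^sub>R axis 1 1 + g x *\<^sub>R axis 2 1 + h x *\<^sub>R axis 3 1 + k x *\<^sub>R axis 4 1" for x
    by (simp add: vec_eq_iff forall_4 axis_def)
  then show ?thesis using assms by simp
qed

text \<open>Serves both the boundary curve and the perturbation of the last coordinate that shows a
  point to lie outside the interior.\<close>

lemma continuous_on_vector_4:
  fixes f g h k :: "'a::topological_space \<Rightarrow> real"
  assumes "continuous_on S f" "continuous_on S g" "continuous_on S h" "continuous_on S k"
  shows "continuous_on S (\<lambda>x. vector [f x, g x, h x, k x] :: real^4)"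
proof -
  have "(vector [f x, g x, h x, k x] :: real^4)
      = f x *\<^sub>R axis 1 1 + g x *\<^sub>R axis 2 1 + h x *\<^sub>R axis 3 1 + k x *\<^sub>R axis 4 1" for x
    by (simp add: vec_eq_iff forall_4 axis_def)
  then show ?thesis using assms by (simp only:) (intro continuous_intros)
qed

section \<open>Lebesgue measure on the plane and on four-space as a product\<close>

lemma prod_Basis_vec:
  fixes F :: "real^'n \<Rightarrow> 'b::comm_monoid_mult"
  shows "prod F Basis = (\<Prod>i\<in>UNIV. F (axis i 1))"
proof -
  have inj: "inj (\<lambda>i::'n. axis i (1::real))" by (auto simp: inj_on_def axis_eq_axis)
  have Basis: "(Basis :: (real^'n) set) = range (\<lambda>i. axis i 1)"
    by (auto simp: Basis_vec_def)
  show ?thesis unfolding Basis by (subst prod.reindex[OF inj]) simp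
qed

lemma emeasure_lborel_box_vec:
  fixes l u :: "real^'n"
  assumes "\<forall>i. l $ i \<le> u $ i"
  shows "emeasure lborel (box l u) = (\<Prod>i\<in>UNIV. u $ i - l $ i)"
proof -
  have "\<forall>b\<in>Basis. l \<bullet> b \<le> u \<bullet> b"
    using assms by (auto simp: Basis_vec_def inner_axis)
  then show ?thesis
    by (simp add: emeasure_lborel_box_eq prod_Basis_vec inner_axis)
qed

text \<open>Lebesgue measure is determined by the volumes of boxes, and the preimage of a box under
  the pairing map is a rectangle whose product measure has the same value.\<close>

lemma lborel_real2:
  "(lborel :: (real^2) measure)
     = distr (lborel \<Otimes>\<^sub>M lborel) borel (\<lambda>(x, y). vector [x, y])"
proof (rule lborel_eqI)
  fix l u :: "real^2"
  assume le: "\<And>b. b \<in> Basis \<Longrightarrow> l \<bullet> b \<le> u \<bullet> b"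
  have le: "l $ i \<le> u $ i" for i
    using le[of "axis i 1"] by (simp add: inner_axis)
  have pre: "(\<lambda>(x, y). vector [x, y] :: real^2) -` box l u
      = {l $ 1 <..< u $ 1} \<times> {l $ 2 <..< u $ 2}"
    by (auto simp: mem_box_cart forall_2)
  have "emeasure (distr (lborel \<Otimes>\<^sub>M lborel) borel (\<lambda>(x, y). vector [x, y] :: real^2)) (box l u)
      = emeasure (lborel \<Otimes>\<^sub>M lborel) ({l $ 1 <..< u $ 1} \<times> {l $ 2 <..< u $ 2})"
    by (subst emeasure_distr) (auto simp: pre space_pair_measure)
  also have "\<dots> = ennreal (\<Prod>b\<in>Basis. (u - l) \<bullet> b)"
    using le[of 1] le[of 2]
    by (simp add: lborel.emeasure_pair_measure_Times prod_Basis_vec UNIV_2 inner_axis ennreal_mult)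
  finally show "emeasure (distr (lborel \<Otimes>\<^sub>M lborel) borel (\<lambda>(x, y). vector [x, y] :: real^2)) (box l u)
      = ennreal (\<Prod>b\<in>Basis. (u - l) \<bullet> b)" .
qed simp

text \<open>Four-space is split into two planes rather than four lines, to match the density of
  \<open>\<mu>\<^sub>4\<close>, which is a product of two planar factors. Boxes again determine the
  measure.\<close>

lemma lborel_real4:
  "(lborel :: (real^4) measure)
     = distr (lborel \<Otimes>\<^sub>M lborel) borel
         (\<lambda>(x :: real^2, y :: real^2). vector [x $ 1, x $ 2, y $ 1, y $ 2])"
    (is "_ = distr _ _ ?T")
proof (rule lborel_eqI)
  fix l u :: "real^4"
  assume le: "\<And>b. b \<in> Basis \<Longrightarrow> l \<bullet> b \<le> u \<bullet> b"
  have le: "l $ i \<le> u $ i" for i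
    using le[of "axis i 1"] by (simp add: inner_axis)
  have pre: "?T -` box l u
      = box (vector [l $ 1, l $ 2]) (vector [u $ 1, u $ 2])
        \<times> box (vector [l $ 3, l $ 4]) (vector [u $ 3, u $ 4])"
    by (auto simp: mem_box_cart forall_2 forall_4)
  have "(\<Prod>b\<in>Basis. (u - l) \<bullet> b) = (\<Prod>i\<in>UNIV. u $ i - l $ i)"
    by (simp add: prod_Basis_vec inner_axis)
  also have "\<dots> = (u $ 1 - l $ 1) * (u $ 2 - l $ 2) * ((u $ 3 - l $ 3) * (u $ 4 - l $ 4))"
    unfolding UNIV_4 by (simp add: mult.assoc)
  finally have prod4: "(\<Prod>b\<in>Basis. (u - l) \<bullet> b)
      = (u $ 1 - l $ 1) * (u $ 2 - l $ 2) * ((u $ 3 - l $ 3) * (u $ 4 - l $ 4))" .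
  have "emeasure (distr (lborel \<Otimes>\<^sub>M lborel) borel ?T) (box l u)
      = emeasure (lborel \<Otimes>\<^sub>M lborel)
          (box (vector [l $ 1, l $ 2] :: real^2) (vector [u $ 1, u $ 2])
            \<times> box (vector [l $ 3, l $ 4] :: real^2) (vector [u $ 3, u $ 4]))"
    by (subst emeasure_distr) (auto simp: pre space_pair_measure)
  also have "\<dots> = emeasure lborel (box (vector [l $ 1, l $ 2] :: real^2) (vector [u $ 1, u $ 2]))
      * emeasure lborel (box (vector [l $ 3, l $ 4] :: real^2) (vector [u $ 3, u $ 4]))"
    by (rule lborel.emeasure_pair_measure_Times) auto
  also have "\<dots> = ennreal ((u $ 1 - l $ 1) * (u $ 2 - l $ 2)) * ennreal ((u $ 3 - l $ 3) * (u $ 4 - l $ 4))"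
    using le by (subst (1 2) emeasure_lborel_box_vec) (simp_all add: forall_2 UNIV_2)
  also have "\<dots> = ennreal (\<Prod>b\<in>Basis. (u - l) \<bullet> b)"
    by (subst ennreal_mult[symmetric]) (simp_all add: le prod4)
  finally show "emeasure (distr (lborel \<Otimes>\<^sub>M lborel) borel ?T) (box l u)
      = ennreal (\<Prod>b\<in>Basis. (u - l) \<bullet> b)" .
qed simp

lemma nn_integral_lborel_real2:
  fixes F :: "real^2 \<Rightarrow> ennreal"
  assumes [measurable]: "F \<in> borel_measurable borel"
  shows "(\<integral>\<^sup>+\<xi>. F \<xi> \<partial>lborel) = (\<integral>\<^sup>+x. \<integral>\<^sup>+y. F (vector [x, y]) \<partial>lborel \<partial>lborel)"
  by (subst lborel_real2, subst nn_integral_distr)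
     (simp_all add: case_prod_unfold lborel.nn_integral_fst[symmetric])

lemma nn_integral_lborel_real4:
  fixes F :: "real^4 \<Rightarrow> ennreal"
  assumes [measurable]: "F \<in> borel_measurable borel"
  shows "(\<integral>\<^sup>+\<xi>. F \<xi> \<partial>lborel)
    = (\<integral>\<^sup>+x. \<integral>\<^sup>+y. F (vector [x $ 1, x $ 2, y $ 1, y $ 2]) \<partial>(lborel :: (real^2) measure)
        \<partial>(lborel :: (real^2) measure))"
  by (subst lborel_real4, subst nn_integral_distr)
     (simp_all add: case_prod_unfold lborel.nn_integral_fst[symmetric])

section \<open>Product formula and reduction to a one-dimensional integral\<close>

lemma borel_measurable_f\<^sub>2 [measurable]: "f\<^sub>2 \<in> borel_measurable borel"
  unfolding f\<^sub>2_def[abs_def] by measurable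

lemma inner_vector_2: "(vector [a, b] :: real^2) \<bullet> x = a * x $ 1 + b * x $ 2"
  by (simp add: inner_vec_def UNIV_2)

lemma inner_vector_4:
  "(vector [a, b, c, d] :: real^4) \<bullet> x = a * x $ 1 + b * x $ 2 + c * x $ 3 + d * x $ 4"
  unfolding inner_vec_def UNIV_4 by (simp add: add.assoc)

text \<open>Density and exponential both factor over the two planes, so Tonelli splits the integral.
  Working in \<open>ennreal\<close>, this needs no finiteness and covers points outside the domain
  as well.\<close>

lemma mgf_\<mu>\<^sub>4: "mgf \<mu>\<^sub>4 (vector [a, b, c, d]) = G\<^sub>2 (vector [a, b]) * G\<^sub>2 (vector [c, d])"
proof -
  have split: "ennreal (f\<^sub>2 x * f\<^sub>2 y)
        * ennreal (exp (vector [a, b, c, d] \<bullet> (vector [x $ 1, x $ 2, y $ 1, y $ 2] :: real^4)))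
      = ennreal (exp (vector [a, b] \<bullet> x) * f\<^sub>2 x) * ennreal (exp (vector [c, d] \<bullet> y) * f\<^sub>2 y)"
    for x y :: "real^2"
  proof -
    have "f\<^sub>2 x * f\<^sub>2 y * exp (vector [a, b, c, d] \<bullet> (vector [x $ 1, x $ 2, y $ 1, y $ 2] :: real^4))
      = (exp (vector [a, b] \<bullet> x) * f\<^sub>2 x) * (exp (vector [c, d] \<bullet> y) * f\<^sub>2 y)"
      by (simp add: inner_vector_2 inner_vector_4 exp_add mult_ac)
    then show ?thesis
      by (simp add: less_imp_le[OF f\<^sub>2_pos] flip: ennreal_mult)
  qed
  have "mgf \<mu>\<^sub>4 (vector [a, b, c, d])
      = (\<integral>\<^sup>+\<xi>. ennreal (f\<^sub>2 (vector [\<xi> $ 1, \<xi> $ 2]) * f\<^sub>2 (vector [\<xi> $ 3, \<xi> $ 4]))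
          * ennreal (exp (vector [a, b, c, d] \<bullet> \<xi>)) \<partial>(lborel :: (real^4) measure))"
    unfolding mgf_def \<mu>\<^sub>4_def by (subst nn_integral_density) auto
  also have "\<dots> = (\<integral>\<^sup>+x. \<integral>\<^sup>+y. ennreal (exp (vector [a, b] \<bullet> x) * f\<^sub>2 x)
      * ennreal (exp (vector [c, d] \<bullet> y) * f\<^sub>2 y) \<partial>(lborel :: (real^2) measure) \<partial>(lborel :: (real^2) measure))"
    by (subst nn_integral_lborel_real4) (simp_all add: vector_2_eta split)
  also have "\<dots> = G\<^sub>2 (vector [a, b]) * G\<^sub>2 (vector [c, d])"
    unfolding G\<^sub>2_def by (simp add: nn_integral_cmult nn_integral_multc)
  finally show ?thesis .
qed

text \<open>Completing the square turns the integrand into a constant multiple of the normal density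
  with mean 2 s u and variance 2 s, whose total mass is 1.\<close>

lemma nn_integral_gaussian:
  fixes s u :: real
  assumes "s > 0"
  shows "(\<integral>\<^sup>+y. ennreal (exp (u * y - y\<^sup>2 / (4 * s))) \<partial>lborel)
    = ennreal (2 * sqrt (pi * s) * exp (s * u\<^sup>2))"
proof -
  define \<sigma> where "\<sigma> = sqrt (2 * s)"
  have \<sigma>: "\<sigma> > 0" "\<sigma>\<^sup>2 = 2 * s" using assms by (auto simp: \<sigma>_def)
  have sq: "sqrt (2 * pi * \<sigma>\<^sup>2) = 2 * sqrt (pi * s)"
  proof -
    have "2 * pi * \<sigma>\<^sup>2 = 2\<^sup>2 * (pi * s)" by (simp add: \<sigma>)
    then show ?thesis by (simp only: real_sqrt_mult) simp
  qed
  have ex: "u * y - y\<^sup>2 / (4 * s) = s * u\<^sup>2 + - (y - 2 * s * u)\<^sup>2 / (2 * \<sigma>\<^sup>2)" for y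
    using assms unfolding \<sigma> by (simp add: field_simps power2_eq_square)
  have eq: "exp (u * y - y\<^sup>2 / (4 * s))
      = (2 * sqrt (pi * s) * exp (s * u\<^sup>2)) * normal_density (2 * s * u) \<sigma> y" for y
    using assms unfolding ex exp_add normal_density_def sq by simp
  have "emeasure (density lborel (normal_density (2 * s * u) \<sigma>)) UNIV = 1"
    using prob_space.emeasure_space_1[OF prob_space_normal_density[OF \<sigma>(1)]] by simp
  then have "(\<integral>\<^sup>+y. ennreal (normal_density (2 * s * u) \<sigma> y) \<partial>lborel) = 1"
    by (simp add: emeasure_density)
  then show ?thesis
    using assms by (simp add: eq ennreal_mult nn_integral_cmult)
qed

text \<open>For fixed first coordinate x, the integral over the second one is Gaussian with s = 1 +
  x^2. Its value supplies exp(s b^2), which splits into exp(b^2) and a correction of the quadratic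
  term, and a factor sqrt(s).\<close>

lemma G\<^sub>2_eq:
  "G\<^sub>2 (vector [a, b])
    = ennreal (exp (b\<^sup>2)) * (\<integral>\<^sup>+x. ennreal (exp (a * x - (1 - b\<^sup>2) * x\<^sup>2) / (1 + x\<^sup>2)) \<partial>lborel)"
proof -
  have inner: "(\<integral>\<^sup>+y. ennreal (exp (vector [a, b] \<bullet> (vector [x, y] :: real^2)) * f\<^sub>2 (vector [x, y])) \<partial>lborel)
      = ennreal (exp (b\<^sup>2)) * ennreal (exp (a * x - (1 - b\<^sup>2) * x\<^sup>2) / (1 + x\<^sup>2))" for x
  proof -
    define s where "s = 1 + x\<^sup>2"
    define C where "C = exp (a * x - x\<^sup>2) * (s powr (- (3 / 2)) / (2 * sqrt pi))"
    have s: "s > 0" unfolding s_def by (simp add: add_pos_nonneg)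
    have C: "C \<ge> 0" using s by (simp add: C_def)
    \<comment> \<open>The power -3/2 in the density is chosen for this: the Gaussian normalisation
      raises it to -1 and leaves the kernel 1 / (1 + x^2).\<close>
    have "s powr (- (3 / 2)) * sqrt s = s powr (- 1)"
      using s by (simp add: powr_half_sqrt[symmetric] flip: powr_add)
    then have ps: "s powr (- (3 / 2)) * sqrt s = 1 / s"
      using s by (simp add: powr_minus_divide)
    have "C * (2 * sqrt (pi * s) * exp (s * b\<^sup>2))
        = exp (a * x - x\<^sup>2) * exp (s * b\<^sup>2) * (s powr (- (3 / 2)) * sqrt s)"
      by (simp add: C_def real_sqrt_mult)
    also have "\<dots> = exp (b\<^sup>2) * (exp (a * x - (1 - b\<^sup>2) * x\<^sup>2) / s)"
      unfolding ps by (simp add: s_def algebra_simps flip: exp_add)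
    finally have K: "C * (2 * sqrt (pi * s) * exp (s * b\<^sup>2))
        = exp (b\<^sup>2) * (exp (a * x - (1 - b\<^sup>2) * x\<^sup>2) / s)" .
    have "exp (vector [a, b] \<bullet> (vector [x, y] :: real^2)) * f\<^sub>2 (vector [x, y])
        = C * exp (b * y - y\<^sup>2 / (4 * s))" for y
      by (simp add: inner_vector_2 f\<^sub>2_def C_def s_def exp_add exp_diff exp_minus field_simps)
    then have "(\<integral>\<^sup>+y. ennreal (exp (vector [a, b] \<bullet> (vector [x, y] :: real^2)) * f\<^sub>2 (vector [x, y])) \<partial>lborel)
        = ennreal C * (\<integral>\<^sup>+y. ennreal (exp (b * y - y\<^sup>2 / (4 * s))) \<partial>lborel)"
      using C by (simp add: ennreal_mult nn_integral_cmult)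
    also have "\<dots> = ennreal (C * (2 * sqrt (pi * s) * exp (s * b\<^sup>2)))"
      using C s by (simp add: nn_integral_gaussian ennreal_mult)
    also have "\<dots> = ennreal (exp (b\<^sup>2)) * ennreal (exp (a * x - (1 - b\<^sup>2) * x\<^sup>2) / s)"
      unfolding K using s by (intro ennreal_mult) auto
    finally show ?thesis by (simp add: s_def)
  qed
  have "G\<^sub>2 (vector [a, b]) = (\<integral>\<^sup>+x. \<integral>\<^sup>+y.
      ennreal (exp (vector [a, b] \<bullet> (vector [x, y] :: real^2)) * f\<^sub>2 (vector [x, y])) \<partial>lborel \<partial>lborel)"
    unfolding G\<^sub>2_def by (subst nn_integral_lborel_real2) simp_all
  then show ?thesis by (simp add: inner nn_integral_cmult)
qed

section \<open>Values, finiteness and growth of the planar generating function\<close>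

lemma nn_integral_inverse_1_plus_square:
  "(\<integral>\<^sup>+x. ennreal (1 / (1 + (x :: real)\<^sup>2)) \<partial>lborel) = ennreal pi"
proof -
  have "integrable lborel (\<lambda>x::real. inverse (1 + x\<^sup>2))"
    using integrable_inverse_1_plus_square by (simp add: set_integrable_def einterval_def)
  moreover have "integral\<^sup>L lborel (\<lambda>x::real. inverse (1 + x\<^sup>2)) = pi"
    using LBINT_inverse_1_plus_square
    by (simp add: interval_lebesgue_integral_def set_lebesgue_integral_def einterval_def)
  ultimately show ?thesis
    by (subst nn_integral_eq_integral) (auto simp: divide_inverse)
qed

text \<open>At a = 0, b = 1 the exponent vanishes identically, so only the kernel 1 / (1 + x^2) with
  integral pi remains.\<close>

lemma G\<^sub>2_0_1: "G\<^sub>2 (vector [0, 1]) = ennreal (exp 1 * pi)"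
  by (simp add: G\<^sub>2_eq nn_integral_inverse_1_plus_square ennreal_mult)

text \<open>For |b| < 1 the exponent is a concave quadratic, hence bounded above, and the integrand
  is dominated by a multiple of 1 / (1 + x^2).\<close>

lemma G\<^sub>2_finite:
  assumes "\<bar>b\<bar> < 1"
  shows "G\<^sub>2 (vector [a, b]) < \<infinity>"
proof -
  define \<epsilon> where "\<epsilon> = 1 - b\<^sup>2"
  have \<epsilon>: "\<epsilon> > 0" using assms by (simp add: \<epsilon>_def abs_square_less_1)
  have "a * x - \<epsilon> * x\<^sup>2 \<le> a\<^sup>2 / (4 * \<epsilon>)" for x
  proof -
    \<comment> \<open>The bound is the maximum of the quadratic, attained at x = a / (2 \<epsilon>);
      the difference is a square.\<close>
    have "a\<^sup>2 / (4 * \<epsilon>) - (a * x - \<epsilon> * x\<^sup>2) = (a - 2 * \<epsilon> * x)\<^sup>2 / (4 * \<epsilon>)"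
      using \<epsilon> by (simp add: field_simps power2_eq_square)
    also have "\<dots> \<ge> 0" using \<epsilon> by simp
    finally show ?thesis by simp
  qed
  then have "exp (a * x - \<epsilon> * x\<^sup>2) / (1 + x\<^sup>2) \<le> exp (a\<^sup>2 / (4 * \<epsilon>)) * (1 / (1 + x\<^sup>2))" for x
    by (simp add: divide_right_mono)
  then have "(\<integral>\<^sup>+x. ennreal (exp (a * x - \<epsilon> * x\<^sup>2) / (1 + x\<^sup>2)) \<partial>lborel)
      \<le> (\<integral>\<^sup>+x. ennreal (exp (a\<^sup>2 / (4 * \<epsilon>))) * ennreal (1 / (1 + x\<^sup>2)) \<partial>lborel)"
    by (intro nn_integral_mono) (simp add: ennreal_leI flip: ennreal_mult)
  also have "\<dots> = ennreal (exp (a\<^sup>2 / (4 * \<epsilon>))) * ennreal pi"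
    by (subst nn_integral_cmult, measurable) (simp add: nn_integral_inverse_1_plus_square)
  also have "\<dots> < \<infinity>" by (simp add: ennreal_mult_less_top)
  finally show ?thesis unfolding G\<^sub>2_eq \<epsilon>_def by (simp add: ennreal_mult_less_top)
qed

text \<open>The integrand is strictly positive, so a zero integral would make the whole plane a null
  set. Positivity rules out the convention 0 * \<infinity> = 0 in the product formula and shows that
  \<open>\<mu>\<^sub>4\<close> has nonzero mass.\<close>

lemma G\<^sub>2_pos: "G\<^sub>2 (vector [a, b]) \<noteq> 0"
proof
  assume "G\<^sub>2 (vector [a, b]) = 0"
  then have "AE \<xi> in (lborel :: (real^2) measure). ennreal (exp (vector [a, b] \<bullet> \<xi>) * f\<^sub>2 \<xi>) = 0"
    unfolding G\<^sub>2_def by (subst (asm) nn_integral_0_iff_AE) auto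
  then have "AE \<xi> in (lborel :: (real^2) measure). False"
    by eventually_elim (simp add: ennreal_eq_0_iff mult_le_0_iff f\<^sub>2_pos not_le[THEN iffD2])
  then have "emeasure (lborel :: (real^2) measure) UNIV = 0"
    by (simp add: AE_iff_measurable[OF _ refl])
  then show False by simp
qed

text \<open>Beyond b = 1 the quadratic term changes sign, and the integrand stays above a positive
  constant on the whole line.\<close>

lemma G\<^sub>2_infinite:
  assumes "b > 1"
  shows "G\<^sub>2 (vector [0, b]) = \<infinity>"
proof -
  define \<delta> where "\<delta> = b\<^sup>2 - 1"
  have \<delta>: "\<delta> > 0" using assms by (simp add: \<delta>_def one_less_power)
  have "min 1 \<delta> \<le> exp (0 * x - (1 - b\<^sup>2) * x\<^sup>2) / (1 + x\<^sup>2)" for x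
  proof -
    \<comment> \<open>The minimum compares the two summands separately: at most 1 against 1, at most
      \<delta> against the coefficient of x^2.\<close>
    have "min 1 \<delta> * (1 + x\<^sup>2) \<le> 1 + \<delta> * x\<^sup>2"
      unfolding distrib_left by (intro add_mono) (auto intro: mult_right_mono)
    also have "\<dots> \<le> exp (\<delta> * x\<^sup>2)" by (rule exp_ge_add_one_self)
    finally show ?thesis
      by (subst pos_le_divide_eq) (auto simp: add_pos_nonneg \<delta>_def algebra_simps)
  qed
  then have "(\<integral>\<^sup>+x. ennreal (min 1 \<delta>) \<partial>(lborel :: real measure))
      \<le> (\<integral>\<^sup>+x. ennreal (exp (0 * x - (1 - b\<^sup>2) * x\<^sup>2) / (1 + x\<^sup>2)) \<partial>lborel)"
    by (intro nn_integral_mono ennreal_leI)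
  moreover have "(\<integral>\<^sup>+x. ennreal (min 1 \<delta>) \<partial>(lborel :: real measure)) = \<infinity>"
    using \<delta> by (simp add: ennreal_mult_top)
  ultimately have "(\<integral>\<^sup>+x. ennreal (exp (0 * x - (1 - b\<^sup>2) * x\<^sup>2) / (1 + x\<^sup>2)) \<partial>lborel) = \<infinity>"
    by (simp add: top_unique)
  then show ?thesis unfolding G\<^sub>2_eq by (simp add: ennreal_mult_top)
qed

text \<open>With a = 1 / n and 1 - b^2 = a^4 the exponent is x (1/n - x/n^4), with peak at n^3 / 2.
  For n >= 4 the interval from n^2 to 2 n^2 lies to the left of the peak; its length contributes the
  factor n^2.\<close>

lemma G\<^sub>2_lower_bound:
  fixes n :: real
  assumes "n \<ge> 4" "b\<^sup>2 = 1 - (1 / n) ^ 4"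
  shows "ennreal (n\<^sup>2 * (exp (n / 2) / (1 + 4 * n ^ 4))) \<le> G\<^sub>2 (vector [1 / n, b])"
proof -
  define K where "K = exp (n / 2) / (1 + 4 * n ^ 4)"
  have K: "K \<ge> 0" using assms by (simp add: K_def)
  have "K \<le> exp (1 / n * x - (1 - b\<^sup>2) * x\<^sup>2) / (1 + x\<^sup>2)" if "x \<in> {n\<^sup>2 .. 2 * n\<^sup>2}" for x
  proof -
    have x: "n\<^sup>2 \<le> x" "x \<le> 2 * n\<^sup>2" "0 \<le> x" using that by (auto intro: order_trans[of _ "n\<^sup>2"])
    have "x / n ^ 4 \<le> 2 * n\<^sup>2 / n ^ 4" using x assms by (intro divide_right_mono) auto
    also have "\<dots> = 2 / n / n" using assms by (simp add: field_simps eval_nat_numeral)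
    also have "\<dots> \<le> 1 / 2 / n" using assms by (intro divide_right_mono) (auto simp: field_simps)
    \<comment> \<open>On the interval the quadratic term consumes at most half of the linear one;
      this is where n >= 4 enters.\<close>
    finally have r: "1 / 2 / n \<le> 1 / n - x / n ^ 4" by simp
    have "n / 2 = n\<^sup>2 * (1 / 2 / n)" using assms by (simp add: power2_eq_square)
    also have "\<dots> \<le> x * (1 / n - x / n ^ 4)" using x r assms by (intro mult_mono) auto
    also have "\<dots> = 1 / n * x - (1 - b\<^sup>2) * x\<^sup>2"
      unfolding assms(2) by (simp add: algebra_simps power2_eq_square power_one_over)
    finally have "exp (n / 2) \<le> exp (1 / n * x - (1 - b\<^sup>2) * x\<^sup>2)" by simp
    moreover have "x\<^sup>2 \<le> (2 * n\<^sup>2)\<^sup>2" using x by (intro power_mono) auto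
    then have "1 + x\<^sup>2 \<le> 1 + 4 * n ^ 4" by (simp add: power_mult_distrib flip: power_mult)
    ultimately show ?thesis unfolding K_def by (intro frac_le) (auto simp: add_pos_nonneg)
  qed
  then have "(\<integral>\<^sup>+x. ennreal K * indicator {n\<^sup>2 .. 2 * n\<^sup>2} x \<partial>lborel)
      \<le> (\<integral>\<^sup>+x. ennreal (exp (1 / n * x - (1 - b\<^sup>2) * x\<^sup>2) / (1 + x\<^sup>2)) \<partial>lborel)"
    by (intro nn_integral_mono) (auto simp: indicator_def ennreal_leI)
  moreover have "(\<integral>\<^sup>+x. ennreal K * indicator {n\<^sup>2 .. 2 * n\<^sup>2} x \<partial>lborel) = ennreal (n\<^sup>2 * K)"
    using K by (simp add: nn_integral_cmult_indicator ennreal_mult mult.commute)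
  \<comment> \<open>The prefactor exp(b^2) is at least 1 and is bounded below by the explicit factor
    1.\<close>
  ultimately have "1 * ennreal (n\<^sup>2 * K) \<le> G\<^sub>2 (vector [1 / n, b])"
    unfolding G\<^sub>2_eq by (intro mult_mono) (auto simp: ennreal_ge_1)
  then show ?thesis by (simp add: K_def)
qed

section \<open>The domain in four-space and its boundary\<close>

lemma V\<^sub>4_iff: "vector [a, b, c, d] \<in> V\<^sub>4 \<longleftrightarrow> vector [a, b] \<in> V\<^sub>2 \<and> vector [c, d] \<in> V\<^sub>2"
  \<comment> \<open>Since neither factor is zero, an infinite factor forces an infinite
    product.\<close>
  using G\<^sub>2_pos[of a b] G\<^sub>2_pos[of c d]
  by (auto simp: V\<^sub>4_def mgf_domain_def mgf_\<mu>\<^sub>4 V\<^sub>2_def ennreal_mult_less_top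
      less_top[symmetric] ennreal_mult_eq_top_iff)

text \<open>The point itself lies in \<open>V\<^sub>4\<close>, while any increase of its last
  coordinate beyond 1 makes the second planar factor infinite. The first two coordinates are thus
  free to move within \<open>V\<^sub>2\<close>.\<close>

lemma frontier_V\<^sub>4:
  assumes "vector [a, b] \<in> V\<^sub>2"
  shows "vector [a, b, 0, 1] \<in> frontier V\<^sub>4"
proof -
  have "vector [a, b, 0, 1] \<in> V\<^sub>4"
    using assms by (simp add: V\<^sub>4_iff) (simp add: V\<^sub>2_def G\<^sub>2_0_1)
  moreover have "vector [a, b, 0, 1] \<notin> interior V\<^sub>4"
  proof
    assume "vector [a, b, 0, 1] \<in> interior V\<^sub>4"
    \<comment> \<open>The summand 0 gives the point the form of the limit of the perturbed points as
      h tends to 0.\<close>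
    then have 1: "vector [a, b, 0, 1 + 0] \<in> interior V\<^sub>4" by simp
    have "continuous_on UNIV (\<lambda>h. vector [a, b, 0, 1 + h] :: real^4)"
      by (intro continuous_on_vector_4 continuous_intros)
    then have "((\<lambda>h. vector [a, b, 0, 1 + h] :: real^4) \<longlongrightarrow> vector [a, b, 0, 1 + 0]) (at 0)"
      unfolding continuous_on_def by (rule bspec) simp
    then have "((\<lambda>h. vector [a, b, 0, 1 + h] :: real^4) \<longlongrightarrow> vector [a, b, 0, 1 + 0]) (at_right 0)"
      by (rule tendsto_within_subset) simp
    then have "eventually (\<lambda>h. vector [a, b, 0, 1 + h] \<in> interior V\<^sub>4) (at_right (0::real))"
      by (rule topological_tendstoD) (use 1 in auto)
    moreover have "eventually (\<lambda>h. h > 0) (at_right (0::real))"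
      by (simp add: eventually_at_right_less)
    ultimately have "eventually (\<lambda>h. vector [a, b, 0, 1 + h] \<in> interior V\<^sub>4 \<and> h > 0) (at_right (0::real))"
      by (rule eventually_conj)
    then obtain h :: real where h: "vector [a, b, 0, 1 + h] \<in> interior V\<^sub>4" "h > 0"
      using eventually_happens' trivial_limit_at_right_real by blast
    then have "vector [0, 1 + h] \<in> V\<^sub>2"
      using interior_subset V\<^sub>4_iff by blast
    with h show False by (simp add: V\<^sub>2_def G\<^sub>2_infinite)
  qed
  ultimately show ?thesis
    using closure_subset by (auto simp: frontier_def)
qed

text \<open>In the open unit ball every coordinate is below 1 in absolute value, so both planar
  factors are finite.\<close>

lemma interior_V\<^sub>4_nonempty: "interior V\<^sub>4 \<noteq> {}"
proof -
  have "ball 0 1 \<subseteq> V\<^sub>4"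
  proof
    fix x :: "real^4"
    assume "x \<in> ball 0 1"
    then have "\<bar>x $ i\<bar> < 1" for i
      using component_le_norm_cart[of x i] by simp
    then have "vector [x $ 1, x $ 2, x $ 3, x $ 4] \<in> V\<^sub>4"
      unfolding V\<^sub>4_iff by (simp add: V\<^sub>2_def G\<^sub>2_finite[unfolded infinity_ennreal_def])
    then show "x \<in> V\<^sub>4" by (simp add: vector_4_eta)
  qed
  then have "0 \<in> interior V\<^sub>4" unfolding mem_interior by (metis zero_less_one)
  then show ?thesis by auto
qed

section \<open>Normalisation and the discontinuous boundary curve\<close>

theorem mainTheorem2:
  shows
    "{vector [u1, u2, 0, 1] | u1 u2. vector [u1, u2] \<in> V\<^sub>2} \<subseteq> frontier V\<^sub>4
     \<and> (\<forall>u1 u2. vector [u1, u2] \<in> V\<^sub>2 \<longrightarrow>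
          G\<^sub>4 (vector [u1, u2, 0, 1]) = ennreal (exp 1 * pi) * G\<^sub>2 (vector [u1, u2]))
     \<and> (\<exists>\<nu> :: (real^4) measure.
          prob_space \<nu> \<and> sets \<nu> = sets borel \<and> interior (mgf_domain \<nu>) \<noteq> {} \<and>
          (\<exists>(c :: real \<Rightarrow> real^4) (t :: nat \<Rightarrow> real) (p :: ennreal) (r :: nat \<Rightarrow> nat).
             continuous_on {0..1} c \<and>
             c ` {0..1} \<subseteq> frontier (mgf_domain \<nu>) \<and>
             c ` {0..<1} \<subseteq> mgf_domain \<nu> \<and>
             incseq t \<and> range t \<subseteq> {0..<1} \<and> t \<longlonglongrightarrow> 1 \<and>
             strict_mono r \<and>
             (\<lambda>k. mgf \<nu> (c (t (r k)))) \<longlonglongrightarrow> p \<and>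
             p \<noteq> mgf \<nu> (c 1)))"
proof (intro conjI)
  show "{vector [u1, u2, 0, 1] | u1 u2. vector [u1, u2] \<in> V\<^sub>2} \<subseteq> frontier V\<^sub>4"
    using frontier_V\<^sub>4 by auto
  show "\<forall>u1 u2. vector [u1, u2] \<in> V\<^sub>2 \<longrightarrow>
          G\<^sub>4 (vector [u1, u2, 0, 1]) = ennreal (exp 1 * pi) * G\<^sub>2 (vector [u1, u2])"
    by (simp add: G\<^sub>4_def mgf_\<mu>\<^sub>4 G\<^sub>2_0_1 mult.commute)
next
  define m where "m = emeasure \<mu>\<^sub>4 (space \<mu>\<^sub>4)"
  \<comment> \<open>Scaling by a positive finite constant yields a probability measure without
    changing the domain or its frontier.\<close>
  define \<nu> where "\<nu> = scale_measure (inverse m) \<mu>\<^sub>4"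
  have sets_\<mu>: "sets \<mu>\<^sub>4 = sets borel" by (simp add: \<mu>\<^sub>4_def)
  \<comment> \<open>The total mass is the generating function at the origin, so the product formula
    makes it nonzero.\<close>
  have "m = mgf \<mu>\<^sub>4 (vector [0, 0, 0, 0])"
    by (simp add: m_def mgf_def inner_vector_4)
  then have m0: "m \<noteq> 0" by (simp add: mgf_\<mu>\<^sub>4 G\<^sub>2_pos)
  have mfin: "m \<noteq> \<infinity>"
    unfolding m_def by (simp add: finite_measure.emeasure_finite[OF finite_measure_\<mu>\<^sub>4])
  have im: "inverse m \<noteq> 0" "inverse m < \<infinity>"
    using m0 mfin by (auto simp: ennreal_inverse_eq_0_iff less_top[symmetric])
  have mgf_\<nu>: "mgf \<nu> u = inverse m * mgf \<mu>\<^sub>4 u" for u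
    unfolding mgf_def \<nu>_def
    by (rule nn_integral_scale_measure) (simp add: measurable_cong_sets[OF sets_\<mu> refl])
  have dom: "mgf_domain \<nu> = V\<^sub>4"
    using im by (auto simp: mgf_domain_def V\<^sub>4_def mgf_\<nu> less_top[symmetric] ennreal_mult_eq_top_iff)
  \<comment> \<open>With a = 1 - s the first two coordinates are a and sqrt(1 - a^4), so 1 - b^2 =
    a^4 decays faster than a and the linear term wins. The last two coordinates keep the curve on
    the frontier.\<close>
  define c :: "real \<Rightarrow> real^4" where "c s = vector [1 - s, sqrt (1 - (1 - s) ^ 4), 0, 1]" for s
  \<comment> \<open>The offset 4 gives a = 1 / n with n = k + 4 >= 4, as the lower bound
    requires.\<close>
  define t :: "nat \<Rightarrow> real" where "t k = 1 - 1 / (real k + 4)" for k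
  have V2: "vector [1 - s, sqrt (1 - (1 - s) ^ 4)] \<in> V\<^sub>2" if "0 \<le> s" "s \<le> 1" for s
  \<comment> \<open>At the endpoint the second coordinate reaches 1, where the bound for |b| < 1
    fails and the explicit value takes over.\<close>
  proof (cases "s = 1")
    case True
    then show ?thesis by (simp add: V\<^sub>2_def G\<^sub>2_0_1)
  next
    case False
    with that have "0 < (1 - s) ^ 4" "(1 - s) ^ 4 \<le> 1" by (auto intro: power_le_one)
    then have "\<bar>sqrt (1 - (1 - s) ^ 4)\<bar> < 1" by (simp add: real_sqrt_lt_1_iff)
    then show ?thesis by (simp add: V\<^sub>2_def G\<^sub>2_finite[unfolded infinity_ennreal_def])
  qed
  have V2': "vector [0, 1] \<in> V\<^sub>2" by (simp add: V\<^sub>2_def G\<^sub>2_0_1)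
  have "continuous_on {0..1} c"
    unfolding c_def by (intro continuous_on_vector_4 continuous_intros)
  moreover have "c ` {0..1} \<subseteq> frontier (mgf_domain \<nu>)"
    unfolding dom c_def using V2 by (auto intro!: frontier_V\<^sub>4)
  moreover have "c ` {0..<1} \<subseteq> mgf_domain \<nu>"
    unfolding dom c_def using V2 V2' by (auto simp: V\<^sub>4_iff)
  moreover have "incseq t"
    unfolding t_def by (auto simp: incseq_def intro!: divide_left_mono)
  moreover have "range t \<subseteq> {0..<1}"
    by (auto simp: t_def)
  moreover have "t \<longlonglongrightarrow> 1"
    unfolding t_def by real_asymp
  \<comment> \<open>The full sequence already converges in \<open>ennreal\<close>, so the identity
    serves as the subsequence.\<close>
  moreover have "strict_mono (id :: nat \<Rightarrow> nat)"
    by (simp add: strict_mono_def)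
  moreover have "(\<lambda>k. mgf \<nu> (c (t (id k)))) \<longlonglongrightarrow> \<infinity>"
  proof -
    define L :: "nat \<Rightarrow> real" where
      "L k = (real k + 4)\<^sup>2 * (exp ((real k + 4) / 2) / (1 + 4 * (real k + 4) ^ 4))" for k
    have "filterlim L at_top sequentially"
      unfolding L_def by real_asymp
    then have "(\<lambda>k. ennreal (L k)) \<longlonglongrightarrow> \<infinity>"
      by (simp add: ennreal_tendsto_top_eq_at_top)
    \<comment> \<open>The constant \<open>inverse m * G\<^sub>2 (vector [0, 1])\<close> is positive
      and finite, so multiplying by it preserves divergence.\<close>
    then have lim: "(\<lambda>k. inverse m * (ennreal (L k) * G\<^sub>2 (vector [0, 1]))) \<longlonglongrightarrow> \<infinity>"
      using ennreal_tendsto_cmult[of "inverse m * G\<^sub>2 (vector [0, 1])" "\<lambda>k. ennreal (L k)" \<infinity> sequentially] im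
      by (simp add: G\<^sub>2_0_1 ennreal_mult_less_top ennreal_mult_top mult_ac)
    have le: "inverse m * (ennreal (L k) * G\<^sub>2 (vector [0, 1])) \<le> mgf \<nu> (c (t (id k)))" for k
    proof -
      have "(1 / (real k + 4)) ^ 4 \<le> 1" by (intro power_le_one) auto
      then have "ennreal (L k) \<le> G\<^sub>2 (vector [1 / (real k + 4), sqrt (1 - (1 / (real k + 4)) ^ 4)])"
        unfolding L_def by (intro G\<^sub>2_lower_bound) auto
      then show ?thesis
        by (simp add: mgf_\<nu> c_def t_def mgf_\<mu>\<^sub>4 mult_left_mono mult_right_mono)
    qed
    show ?thesis
      using tendsto_sandwich[OF _ _ lim tendsto_const] le by simp
  qed
  \<comment> \<open>At the endpoint both planar factors equal e * pi, so the value is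
    finite.\<close>
  moreover have "\<infinity> \<noteq> mgf \<nu> (c 1)"
    using im by (auto simp: mgf_\<nu> c_def mgf_\<mu>\<^sub>4 G\<^sub>2_0_1 ennreal_mult_eq_top_iff
        dest!: sym[of top])
  moreover have "prob_space \<nu>"
  proof
    have "m / m = 1" using m0 mfin by (simp add: less_top)
    then show "emeasure \<nu> (space \<nu>) = 1"
      by (simp add: \<nu>_def space_scale_measure m_def[symmetric] divide_ennreal_def mult.commute)
  qed
  moreover have "sets \<nu> = sets borel"
    by (simp add: \<nu>_def sets_\<mu>)
  moreover have "interior (mgf_domain \<nu>) \<noteq> {}"
    unfolding dom by (rule interior_V\<^sub>4_nonempty)
  ultimately show "\<exists>\<nu> :: (real^4) measure.
          prob_space \<nu> \<and> sets \<nu> = sets borel \<and> interior (mgf_domain \<nu>) \<noteq> {} \<and>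
          (\<exists>(c :: real \<Rightarrow> real^4) (t :: nat \<Rightarrow> real) (p :: ennreal) (r :: nat \<Rightarrow> nat).
             continuous_on {0..1} c \<and>
             c ` {0..1} \<subseteq> frontier (mgf_domain \<nu>) \<and>
             c ` {0..<1} \<subseteq> mgf_domain \<nu> \<and>
             incseq t \<and> range t \<subseteq> {0..<1} \<and> t \<longlonglongrightarrow> 1 \<and>
             strict_mono r \<and>
             (\<lambda>k. mgf \<nu> (c (t (r k)))) \<longlonglongrightarrow> p \<and>
             p \<noteq> mgf \<nu> (c 1))"
    by blast
qed

end
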